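(* For every integer $n\ge 2$ there exists a reduced integer $m$ with $n\le m\le 4n-6$ such that $|\mathcal{M}_x(n)|\le|\mathcal{M}_x(m)|$ for all $x\in\mathbb{R}$.
   Context: Let $p_i$ denote the $i$-th prime ($p_1=2,p_2=3,\dots$). A positive integer $2^{a_1}3^{a_2}5^{a_3}\cdots=\prod_i p_i^{a_i}$ (with $a_i=0$ for all sufficiently large $i$) is called reduced if $\left\lfloor\frac{a_i+1}{a_j+2}\right\rfloor<\frac{\log p_j}{\log p_i}$ for all $i,j\ne 1$, and $2^{a_1}<8p_j^2$ for every $j$ with $a_j=0$. For a positive integer $n$ and $x\in\mathbb{R}$, a positive divisor $d$ of $n$ is maximal with respect to $x$ if $d\le x$ and there is no other positive divisor $d'$ of $n$ with $d'\le x$ and $d\mid d'$; $\mathcal{M}_x(n)$ denotes the set of such divisors. *)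

theory Defs
  imports Complex_Main "HOL-Library.Infinite_Set" "HOL-Computational_Algebra.Primes"
begin

(* the i-th prime, 1-indexed: ith_prime 1 = 2, ith_prime 2 = 3, ... *)
definition ith_prime :: "nat \<Rightarrow> nat" where
  "ith_prime i = enumerate {p::nat. prime p} (i - 1)"

definition expo :: "nat \<Rightarrow> nat \<Rightarrow> nat" where
  "expo m i = multiplicity (ith_prime i) m"

definition reduced :: "nat \<Rightarrow> bool" where
  "reduced m \<longleftrightarrow> m > 0 \<and>
     (\<forall>i j. 1 < i \<and> 1 < j \<longrightarrow>
        real_of_int \<lfloor>real (expo m i + 1) / real (expo m j + 2)\<rfloor>
          < ln (real (ith_prime j)) / ln (real (ith_prime i))) \<and>
     (\<forall>j\<ge>1. expo m j = 0 \<longrightarrow> (2::nat) ^ expo m 1 < 8 * (ith_prime j)^2)"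

definition maxdivs :: "real \<Rightarrow> nat \<Rightarrow> nat set" where
  "maxdivs x n = {d. d > 0 \<and> d dvd n \<and> real d \<le> x \<and>
      \<not> (\<exists>d'. d' > 0 \<and> d' dvd n \<and> real d' \<le> x \<and> d dvd d' \<and> d' \<noteq> d)}"

end

theory Submission
  imports Defs
begin

text \<open>
  Write \<open>n = 2\<^sup>a * c\<close> with \<open>c\<close> odd. Sending a maximal divisor \<open>d\<close> to the odd part \<open>u\<close> of
  \<open>n / d\<close> is a bijection onto the divisors \<open>u\<close> of \<open>c\<close> with \<open>c / u \<le> x\<close> and \<open>u * x < p * n\<close> for
  all primes \<open>p\<close> dividing \<open>u\<close>. Here \<open>n\<close> enters only as an upper bound, so the count does not
  decrease when \<open>n\<close> grows, and \<open>c\<close> can be changed while \<open>n\<close> is kept as a parameter.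
  Two moves do not decrease the count: replacing \<open>p\<^sup>k\<close> by \<open>q\<close> in \<open>c\<close> when the first condition in
  the definition of reduced integers fails, and adjoining a prime \<open>q\<close> to \<open>c\<close> when \<open>c * q\<^sup>2 \<le> n\<close>.
  Among the odd numbers \<open>c \<le> n\<close> whose count dominates that of \<open>n\<close>, take one with the most
  divisors and, among those, the smallest. For it neither move is possible, so the least
  \<open>m = 2\<^sup>a * c\<close> with \<open>m \<ge> n\<close> is reduced.
\<close>

section \<open>Cofactor sets with a free bound\<close>

text \<open>For \<open>N = 2 ^ a * c\<close> and \<open>t = c div u\<close>, the last inequality
  reads \<open>x < 2 ^ a * t * p\<close>: even if the full power of 2 fits below \<open>x\<close>,
  no prime of \<open>u\<close> can be added.\<close>

definition odd_cofactors :: "nat \<Rightarrow> nat \<Rightarrow> real \<Rightarrow> nat set" where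
  "odd_cofactors N c x = {u. u dvd c \<and> real c \<le> real u * x \<and>
     (\<forall>p. prime p \<and> p dvd u \<longrightarrow> real u * x < real p * real N)}"

lemma finite_odd_cofactors: "c > 0 \<Longrightarrow> finite (odd_cofactors N c x)"
  by (rule finite_subset[of _ "{u. u dvd c}"]) (auto simp: odd_cofactors_def)

lemma odd_cofactors_pos:
  assumes "c > 0" "u \<in> odd_cofactors N c x"
  shows "u > 0" "x > 0"
proof -
  have u: "u dvd c" "real c \<le> real u * x"
    using assms by (auto simp: odd_cofactors_def)
  then show "u > 0" using assms(1) dvd_pos_nat by blast
  have "0 < real u * x" using u assms(1) by linarith
  with \<open>u > 0\<close> show "x > 0" by (simp add: zero_less_mult_iff)
qed

lemma odd_cofactors_mono:
  assumes "N \<le> N'"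
  shows "odd_cofactors N c x \<subseteq> odd_cofactors N' c x"
proof -
  have "real p * real N \<le> real p * real N'" for p
    using assms by (intro mult_left_mono) auto
  then show ?thesis unfolding odd_cofactors_def using less_le_trans by blast
qed

lemma finite_maxdivs: "n > 0 \<Longrightarrow> finite (maxdivs x n)"
  by (rule finite_subset[of _ "{u. u dvd n}"]) (auto simp: maxdivs_def)

lemma odd_decomp_unique:
  fixes s t :: nat
  assumes "2 ^ i * s = 2 ^ j * t" "odd s" "odd t"
  shows "s = t"
proof -
  have *: "multiplicity 2 (2 ^ k * r) = k" if "odd r" for k and r :: nat
    using that by (intro multiplicity_eqI) auto
  have "i = j" using *[of s i] *[of t j] assms by simp
  with assms show ?thesis by simp
qed

lemma odd_decomp:
  fixes n :: nat
  assumes "n > 0"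
  obtains a c where "n = 2 ^ a * c" "odd c"
proof -
  obtain c where "n = 2 ^ multiplicity 2 n * c" "\<not> 2 dvd c"
    using multiplicity_decompose'[of n 2] assms by auto
  then show ?thesis using that by blast
qed

section \<open>Maximal divisors correspond to odd cofactors\<close>

text \<open>If a prime \<open>p\<close> divides the odd part \<open>u\<close> of the complementary
  divisor of \<open>d\<close>, then \<open>d * p\<close> still divides the number, so maximality
  forces \<open>x < d * p\<close>.\<close>

lemma card_maxdivs_le:
  assumes "odd c"
  shows "card (maxdivs x (2 ^ a * c)) \<le> card (odd_cofactors (2 ^ a * c) c x)"
proof -
  let ?n = "2 ^ a * c"
  have c: "c > 0" using assms by (rule odd_pos)
  have ex: "\<exists>e u. ?n = d * (2 ^ e * u) \<and> odd u \<and> u \<in> odd_cofactors ?n c x"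
    if d: "d \<in> maxdivs x ?n" for d
  proof -
    have d1: "d > 0" "d dvd ?n" "real d \<le> x"
      and d2: "\<And>d'. d' > 0 \<Longrightarrow> d' dvd ?n \<Longrightarrow> real d' \<le> x \<Longrightarrow> d dvd d' \<Longrightarrow> d' = d"
      using d by (auto simp: maxdivs_def)
    obtain D where D: "?n = d * D" using d1 by blast
    have "D > 0" using D c by (cases D) auto
    then obtain e u where eu: "D = 2 ^ e * u" "odd u" by (rule odd_decomp)
    obtain e' t where et: "d = 2 ^ e' * t" "odd t" using d1(1) by (rule odd_decomp)
    have "2 ^ a * c = 2 ^ (e' + e) * (t * u)"
      using D eu et by (simp add: power_add mult_ac)
    with odd_decomp_unique[OF this assms] eu et have cu: "c = t * u" by simp
    have "u > 0" using eu(2) by (rule odd_pos)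
    have "t \<le> d" using et by simp
    with d1 have "real t \<le> x" by linarith
    then have "real c \<le> real u * x" unfolding cu using mult_left_mono[of "real t" x "real u"]
      by (simp add: mult.commute)
    moreover have "real u * x < real p * real ?n" if p: "prime p" "p dvd u" for p
    proof -
      have "d * p dvd ?n" unfolding D eu using p by auto
      moreover have "d * p \<noteq> d" using prime_gt_1_nat[OF p(1)] d1 by simp
      moreover have "d * p > 0" using d1 prime_gt_0_nat[OF p(1)] by simp
      ultimately have "\<not> real (d * p) \<le> x" using d2 dvd_triv_left by blast
      then have "x < real (d * p)" by (rule not_le_imp_less)
      then have "real u * x < real u * real (d * p)" using \<open>u > 0\<close> by simp
      also have "\<dots> = real (u * (d * p))" by simp
      also have "\<dots> \<le> real (p * ?n)" unfolding of_nat_le_iff D eu by simp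
      finally show ?thesis by simp
    qed
    ultimately have "u \<in> odd_cofactors ?n c x" using cu by (simp add: odd_cofactors_def)
    with D eu show ?thesis by blast
  qed
  then obtain E U where EU: "\<And>d. d \<in> maxdivs x ?n \<Longrightarrow>
      ?n = d * (2 ^ E d * U d) \<and> odd (U d) \<and> U d \<in> odd_cofactors ?n c x" by metis
  \<comment> \<open>Equal odd cofactors leave only a power of 2 between \<open>d\<close> and
    \<open>d'\<close>, so one divides the other and maximality makes them equal.\<close>
  have le: "d = d'" if d: "d \<in> maxdivs x ?n" and d': "d' \<in> maxdivs x ?n"
    and U: "U d = U d'" and E: "E d' \<le> E d" for d d'
  proof -
    have "d * (2 ^ (E d - E d') * (2 ^ E d' * U d)) = d' * (2 ^ E d' * U d)"
      using EU[OF d] EU[OF d'] U E by (metis le_add_diff_inverse2 mult.assoc power_add)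
    moreover have "2 ^ E d' * U d > 0" using EU[OF d] odd_pos by auto
    ultimately have "d * 2 ^ (E d - E d') = d'" by auto
    then have "d dvd d'" by (metis dvd_triv_left)
    then show ?thesis using d d' by (auto simp: maxdivs_def)
  qed
  have "inj_on U (maxdivs x ?n)"
  proof (rule inj_onI)
    fix d d' assume "d \<in> maxdivs x ?n" "d' \<in> maxdivs x ?n" "U d = U d'"
    then show "d = d'" using le[of d d'] le[of d' d] by (cases "E d' \<le> E d") auto
  qed
  moreover have "U ` maxdivs x ?n \<subseteq> odd_cofactors ?n c x" using EU by auto
  ultimately show ?thesis using finite_odd_cofactors[OF c] by (rule card_inj_on_le)
qed

text \<open>The inverse map sends \<open>u\<close> to \<open>2 ^ e * (c div u)\<close> with
  \<open>e \<le> a\<close> as large as \<open>x\<close> permits.\<close>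

lemma card_odd_cofactors_le:
  assumes "odd c"
  shows "card (odd_cofactors (2 ^ a * c) c x) \<le> card (maxdivs x (2 ^ a * c))"
proof -
  let ?n = "2 ^ a * c"
  have c: "c > 0" using assms by (rule odd_pos)
  have ex: "\<exists>e t. c = t * u \<and> 2 ^ e * t \<in> maxdivs x ?n"
    if u: "u \<in> odd_cofactors ?n c x" for u
  proof -
    have u1: "u dvd c" "real c \<le> real u * x"
      and u2: "\<And>p. prime p \<Longrightarrow> p dvd u \<Longrightarrow> real u * x < real p * real ?n"
      using u by (auto simp: odd_cofactors_def)
    have pos: "u > 0" "x > 0" using odd_cofactors_pos[OF c u] by auto
    obtain t where t: "c = t * u" using u1 by (metis dvd_def mult.commute)
    have "t > 0" using t c by (cases t) auto
    have "real u * real t \<le> real u * x" using u1(2) t by (simp add: mult.commute)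
    then have "real t \<le> x" using pos by simp
    define I where "I = {e. e \<le> a \<and> real (2 ^ e * t) \<le> x}"
    have I: "finite I" "0 \<in> I" using \<open>real t \<le> x\<close> by (auto simp: I_def)
    define e where "e = Max I"
    have "e \<in> I" using I Max_in unfolding e_def by blast
    then have e: "e \<le> a" "real (2 ^ e * t) \<le> x" by (auto simp: I_def)
    have emax: "i \<le> e" if "i \<in> I" for i using that I unfolding e_def by simp
    let ?d = "2 ^ e * t"
    \<comment> \<open>For \<open>e = a\<close> the prime must come from \<open>u\<close>, where the
      cofactor condition applies. For \<open>e < a\<close> doubling already exceeds
      \<open>x\<close>, and \<open>p \<ge> 2\<close>.\<close>
    have large: "x < real (?d * p)" if p: "prime p" "?d * p dvd ?n" for p
    proof (cases "e = a")
      case True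
      then have "p dvd u" using p(2) t \<open>t > 0\<close> by (simp add: mult.assoc)
      then have "real u * x < real p * real ?n" using u2 p by blast
      also have "\<dots> = real u * real (?d * p)" using t True by simp
      finally show ?thesis using pos by simp
    next
      case False
      then have "Suc e \<notin> I" using emax by fastforce
      then have "x < real (?d * 2)" using False e by (auto simp: I_def mult_ac)
      also have "\<dots> \<le> real (?d * p)"
        unfolding of_nat_le_iff using prime_ge_2_nat[OF p(1)] by simp
      finally show ?thesis .
    qed
    have "d' = ?d" if d': "d' > 0" "d' dvd ?n" "real d' \<le> x" "?d dvd d'" for d'
    proof (rule ccontr)
      assume "d' \<noteq> ?d"
      obtain w where w: "d' = ?d * w" using d' by blast
      with \<open>d' \<noteq> ?d\<close> have "w \<noteq> 1" by auto
      then obtain p where p: "prime p" "p dvd w" using prime_factor_nat by blast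
      then have "?d * p dvd d'" using w by simp
      then have "x < real (?d * p)" "?d * p \<le> d'"
        using large[OF p(1)] d' dvd_trans dvd_imp_le by blast+
      with d'(3) show False by linarith
    qed
    moreover have "?d dvd ?n" using e t by (simp add: le_imp_power_dvd mult_dvd_mono)
    ultimately have "?d \<in> maxdivs x ?n" using e \<open>t > 0\<close> by (auto simp: maxdivs_def)
    with t show ?thesis by blast
  qed
  then obtain E T where ET: "\<And>u. u \<in> odd_cofactors ?n c x \<Longrightarrow>
      c = T u * u \<and> 2 ^ E u * T u \<in> maxdivs x ?n" by metis
  have "inj_on (\<lambda>u. 2 ^ E u * T u) (odd_cofactors ?n c x)"
  proof (rule inj_onI)
    fix u v assume u: "u \<in> odd_cofactors ?n c x" and v: "v \<in> odd_cofactors ?n c x"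
      and eq: "2 ^ E u * T u = 2 ^ E v * T v"
    have "odd (T u)" "odd (T v)" using ET[OF u] ET[OF v] assms by (metis even_mult_iff)+
    then have "T u = T v" using eq odd_decomp_unique by blast
    moreover have "T u > 0" using \<open>odd (T u)\<close> by (rule odd_pos)
    ultimately show "u = v" using ET[OF u] ET[OF v] by (metis mult_cancel1 not_gr0)
  qed
  moreover have "(\<lambda>u. 2 ^ E u * T u) ` odd_cofactors ?n c x \<subseteq> maxdivs x ?n" using ET by auto
  ultimately show ?thesis using finite_maxdivs c by (intro card_inj_on_le) auto
qed

section \<open>Two moves that do not decrease the count\<close>

text \<open>Take \<open>c' = c div p ^ k * q\<close>. With \<open>i\<close>, \<open>j\<close> the
  exponents of \<open>p\<close>, \<open>q\<close> in a divisor, those of small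
  \<open>i + k * j\<close> are kept and the others trade \<open>p ^ k\<close> for \<open>q\<close>.
  One injection serves all \<open>N\<close> and \<open>x\<close>, and also shows that
  \<open>c'\<close> has at least as many divisors as \<open>c\<close>.\<close>

lemma exchange_primes:
  fixes c p q k :: nat
  assumes c: "c > 0" and p: "prime p" and q: "prime q" and "p \<noteq> q"
    and qp: "q < p ^ k"
    and k: "k * (multiplicity q c + 2) \<le> multiplicity p c + 1"
  obtains c' f where "c' > 0" "c' < c" "odd c \<Longrightarrow> odd q \<Longrightarrow> odd c'"
    "inj_on f {u. u dvd c}" "f ` {u. u dvd c} \<subseteq> {u. u dvd c'}"
    "\<And>N x. f ` odd_cofactors N c x \<subseteq> odd_cofactors N c' x"
proof -
  let ?a = "multiplicity p c" and ?b = "multiplicity q c"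
  have p0: "p > 0" and q0: "q > 0" using p q prime_gt_0_nat by auto
  have "k > 0" using qp prime_gt_1_nat[OF q] by (cases k) auto
  have "k \<le> ?a"
  proof -
    have "k * 2 \<le> k * (?b + 2)" by simp
    with k \<open>k > 0\<close> show ?thesis by linarith
  qed
  then obtain r where r: "c = p ^ k * r" using multiplicity_dvd' by (meson dvdE)
  have r0: "r > 0" using r c by (cases r) auto
  define c' where "c' = r * q"
  have c'c: "c' < c" unfolding c'_def r using qp r0 by (simp add: mult.commute)
  have multp: "multiplicity p (p ^ k * w) = k + multiplicity p w"
    "multiplicity p (w * q) = multiplicity p w"
    "multiplicity q (p ^ k * w) = multiplicity q w"
    "multiplicity q (w * q) = multiplicity q w + 1" if "w > 0" for w
    using that p q p0 q0 \<open>p \<noteq> q\<close>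
    by (simp_all add: prime_elem_multiplicity_mult_distrib prime_imp_prime_elem
        multiplicity_distinct_prime_power prime_multiplicity_other)
  \<comment> \<open>The move \<open>u \<mapsto> u / p\<^sup>k * q\<close> preserves this weight; it is applied exactly on the
    weights that can occur with a power of \<open>p\<close> too large for \<open>c'\<close>.\<close>
  define g where "g u = multiplicity p u + k * multiplicity q u" for u
  define f where "f u = (if g u \<le> ?a - k then u else u div p ^ k * q)" for u
  \<comment> \<open>With \<open>j \<le> ?b\<close>, a weight above \<open>?a - k\<close> gives
    \<open>i > ?a - k - k * ?b \<ge> k - 1\<close> by the hypothesis on \<open>k\<close>, so
    \<open>p ^ k\<close> divides \<open>u\<close>.\<close>
  have big: "\<exists>w. u = p ^ k * w \<and> w > 0 \<and> w dvd r \<and> f u = w * q"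
    if u: "u dvd c" "\<not> g u \<le> ?a - k" for u
  proof -
    have u0: "u > 0" using u c dvd_pos_nat by blast
    have "multiplicity q u \<le> ?b" using u c by (intro dvd_imp_multiplicity_le) auto
    then have "k * multiplicity q u \<le> k * ?b" by simp
    moreover have "?a - k < multiplicity p u + k * multiplicity q u"
      using u by (simp add: g_def)
    moreover have "k * ?b + 2 * k \<le> ?a + 1" using k by (simp add: algebra_simps)
    ultimately have "k \<le> multiplicity p u" using \<open>k \<le> ?a\<close> by linarith
    then obtain w where w: "u = p ^ k * w" using multiplicity_dvd' by (meson dvdE)
    moreover have "w > 0" using w u0 by (cases w) auto
    moreover have "w dvd r" using u w r p0 by simp
    moreover have "f u = w * q" using u(2) w p0 by (simp add: f_def)
    ultimately show ?thesis by blast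
  qed
  have gf: "g (f u) = g u" if u: "u dvd c" for u
  proof (cases "g u \<le> ?a - k")
    case False
    then obtain w where w: "u = p ^ k * w" "w > 0" "f u = w * q" using big u by blast
    then show ?thesis by (simp add: g_def multp)
  qed (simp add: f_def)
  \<comment> \<open>Since \<open>f\<close> preserves the weight, equal images come from the same
    branch, and each branch is injective.\<close>
  have inj: "inj_on f {u. u dvd c}"
  proof (rule inj_onI, clarify)
    fix u v assume u: "u dvd c" and v: "v dvd c" and eq: "f u = f v"
    have guv: "g u = g v" using gf u v eq by metis
    show "u = v"
    proof (cases "g u \<le> ?a - k")
      case True
      then show ?thesis using guv eq by (simp add: f_def)
    next
      case False
      obtain w where "u = p ^ k * w" "f u = w * q" using big[OF u False] by blast
      moreover obtain w' where "v = p ^ k * w'" "f v = w' * q"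
        using big[OF v] False guv by metis
      ultimately show ?thesis using eq q0 by simp
    qed
  qed
  have fdvd: "f u dvd c'" if u: "u dvd c" for u
  proof (cases "g u \<le> ?a - k")
    case True
    \<comment> \<open>Only the exponent of \<open>p\<close> differs between \<open>c\<close> and
      \<open>r\<close>, and the weight bounds that exponent in \<open>u\<close>.\<close>
    have "u dvd r"
    proof (rule multiplicity_le_imp_dvd)
      show "u \<noteq> 0" using u c by auto
      fix s :: nat assume s: "prime s"
      show "multiplicity s u \<le> multiplicity s r"
      proof (cases "s = p")
        case True
        then show ?thesis using \<open>g u \<le> ?a - k\<close> multp(1)[OF r0] r by (simp add: g_def)
      next
        case False
        have "multiplicity s u \<le> multiplicity s c"
          using u c by (intro dvd_imp_multiplicity_le) auto
        also have "\<dots> = multiplicity s r" unfolding r using s p p0 r0 False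
          by (simp add: prime_elem_multiplicity_mult_distrib prime_imp_prime_elem
              multiplicity_distinct_prime_power)
        finally show ?thesis .
      qed
    qed
    then show ?thesis using True by (simp add: f_def c'_def)
  next
    case False
    then show ?thesis using big[OF u] by (auto simp: c'_def)
  qed
  have fW: "f u \<in> odd_cofactors N c' x" if u: "u \<in> odd_cofactors N c x" for u N x
  proof -
    have u1: "u dvd c" "real c \<le> real u * x"
      and u2: "\<And>s. prime s \<Longrightarrow> s dvd u \<Longrightarrow> real u * x < real s * real N"
      using u by (auto simp: odd_cofactors_def)
    have x: "x > 0" using odd_cofactors_pos[OF c u] by auto
    show ?thesis
    proof (cases "g u \<le> ?a - k")
      case True
      then have "f u = u" by (simp add: f_def)
      moreover have "real c' \<le> real u * x" using u1 c'c by linarith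
      ultimately show ?thesis using fdvd[OF u1(1)] u2 by (auto simp: odd_cofactors_def)
    next
      case False
      then obtain w where w: "u = p ^ k * w" "w > 0" "w dvd r" "f u = w * q"
        using big u1 by blast
      have "real (p ^ k) * real r \<le> real (p ^ k) * (real w * x)"
        using u1(2) unfolding r w(1) by (simp add: mult.assoc)
      then have "real r \<le> real w * x" using p0 by simp
      then have 1: "real c' \<le> real (w * q) * x"
        unfolding c'_def using mult_right_mono[of "real r" "real w * x" "real q"]
        by (simp add: mult_ac)
      have 2: "real (w * q) * x < real s * real N" if s: "prime s" "s dvd w * q" for s
      proof (cases "s dvd w")
        case True
        have "w * q \<le> u" unfolding w(1) using qp by (simp add: mult.commute)
        then have "real (w * q) * x \<le> real u * x"
          using x by (intro mult_right_mono) (simp_all only: of_nat_le_iff less_imp_le)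
        also have "\<dots> < real s * real N" using u2 s True w(1) by simp
        finally show ?thesis .
      next
        case False
        then have "s = q" using s q prime_dvd_mult_iff primes_dvd_imp_eq by blast
        \<comment> \<open>The new prime \<open>q\<close> need not divide \<open>u\<close>, so its
          bound comes from the one for \<open>p\<close>: \<open>u * x < p * N\<close> and
          \<open>p * w \<le> u\<close> give \<open>w * x < N\<close>.\<close>
        have "p dvd u" using w(1) \<open>k > 0\<close> by simp
        then have "real u * x < real p * real N" using u2 p by blast
        moreover have "p * w \<le> u" unfolding w(1) using p0 \<open>k > 0\<close>
          by (simp add: self_le_power)
        then have "real (p * w) * x \<le> real u * x"
          using x by (intro mult_right_mono) (simp_all only: of_nat_le_iff less_imp_le)
        ultimately have "real p * (real w * x) < real p * real N" by (simp add: mult.assoc)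
        then have "real w * x < real N" using p0 by simp
        then have "real q * (real w * x) < real q * real N" using q0 by simp
        then show ?thesis using \<open>s = q\<close> by (simp add: mult_ac)
      qed
      show ?thesis using fdvd[OF u1(1)] 1 2 w(4) by (simp add: odd_cofactors_def)
    qed
  qed
  show ?thesis
  proof (rule that)
    show "c' > 0" using r0 q0 by (simp add: c'_def)
    show "odd c'" if "odd c" "odd q" using that by (auto simp: c'_def r)
    show "f ` {u. u dvd c} \<subseteq> {u. u dvd c'}" using fdvd by auto
    show "f ` odd_cofactors N c x \<subseteq> odd_cofactors N c' x" for N x using fW by auto
  qed (use c'c inj in auto)
qed

text \<open>Keep \<open>u\<close> if it still satisfies the lower bound for \<open>c * q\<close>,
  else multiply it by \<open>q\<close>. In the latter case \<open>u * x < c * q\<close>, so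
  \<open>u * q * x < c * q\<^sup>2 \<le> N\<close>, which suffices for every prime.\<close>

lemma card_odd_cofactors_adjoin_prime:
  assumes c: "c > 0" and q: "prime q" "\<not> q dvd c" and N: "c * q\<^sup>2 \<le> N"
  shows "card (odd_cofactors N c x) \<le> card (odd_cofactors N (c * q) x)"
proof -
  define f where "f u = (if real (c * q) \<le> real u * x then u else u * q)" for u
  have q0: "q > 0" using q prime_gt_0_nat by blast
  have nq: "u * q \<notin> odd_cofactors N c x" for u
    using q dvd_trans[of q "u * q" c] by (auto simp: odd_cofactors_def)
  have "inj_on f (odd_cofactors N c x)"
    by (rule inj_onI) (use nq q0 in \<open>auto simp: f_def split: if_splits\<close>)
  moreover have "f u \<in> odd_cofactors N (c * q) x" if u: "u \<in> odd_cofactors N c x" for u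
  proof (cases "real (c * q) \<le> real u * x")
    case True
    then show ?thesis using u by (auto simp: f_def odd_cofactors_def)
  next
    case False
    have u1: "u dvd c" "real c \<le> real u * x" using u by (auto simp: odd_cofactors_def)
    have "real (c * q) \<le> real (u * q) * x"
      using mult_right_mono[OF u1(2), of "real q"] by (simp add: mult_ac)
    moreover have "real (u * q) * x < real s * real N" if s: "prime s" for s
    proof -
      have "real (u * q) * x = real q * (real u * x)" by simp
      also have "\<dots> < real q * real (c * q)" using False q0 by simp
      also have "\<dots> = real (c * q\<^sup>2)" by (simp add: power2_eq_square)
      also have "\<dots> \<le> real (s * N)"
        unfolding of_nat_le_iff using N prime_gt_0_nat[OF s] by (cases s) auto
      finally show ?thesis by simp
    qed
    ultimately show ?thesis using False u1(1) by (simp add: f_def odd_cofactors_def)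
  qed
  then have "f ` odd_cofactors N c x \<subseteq> odd_cofactors N (c * q) x" by auto
  ultimately show ?thesis using finite_odd_cofactors c q0 by (intro card_inj_on_le) auto
qed

section \<open>Indexed primes\<close>

lemma prime_ith_prime: "prime (ith_prime i)"
  unfolding ith_prime_def using enumerate_in_set[OF primes_infinite] by simp

lemma ith_prime_1: "ith_prime 1 = 2"
proof -
  have "(LEAST p::nat. prime p) = 2"
    by (rule Least_equality) (auto intro: prime_ge_2_nat)
  then show ?thesis by (simp add: ith_prime_def enumerate_0)
qed

lemma odd_ith_prime:
  assumes "i > 1"
  shows "odd (ith_prime i)"
proof -
  have "ith_prime 1 < ith_prime i"
    unfolding ith_prime_def using assms enumerate_mono[OF _ primes_infinite, of "1 - 1" "i - 1"]
    by simp
  then show ?thesis using prime_ith_prime prime_odd_nat unfolding ith_prime_1 by blast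
qed

section \<open>Extremal odd part and the reduced integer\<close>

theorem theorem3p13:
  fixes n :: nat
  assumes "n \<ge> 2"
  shows "\<exists>m::nat. reduced m \<and> n \<le> m \<and> m \<le> 4 * n - 6 \<and>
           (\<forall>x::real. card (maxdivs x n) \<le> card (maxdivs x m))"
proof -
  obtain a0 c0 where n: "n = 2 ^ a0 * c0" "odd c0" using assms odd_decomp[of n] by auto
  \<comment> \<open>The bound parameter is \<open>n\<close> for every candidate, which keeps the
    counts comparable; \<open>c \<le> n\<close> makes the set finite and later controls
    \<open>m\<close>.\<close>
  define S where "S = {c. odd c \<and> c \<le> n \<and>
    (\<forall>x. card (odd_cofactors n c0 x) \<le> card (odd_cofactors n c x))}"
  define tau where "tau c = card {u::nat. u dvd c}" for c
  \<comment> \<open>Orders \<open>S\<close> lexicographically: more divisors first, then smaller.\<close>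
  define wt where "wt c = tau c * (n + 1) + (n - c)" for c
  have "finite S" by (rule finite_subset[of _ "{..n}"]) (auto simp: S_def)
  moreover have "c0 \<in> S" using n by (simp add: S_def)
  ultimately obtain c where c: "c \<in> S" and cmax: "\<And>c'. c' \<in> S \<Longrightarrow> wt c' \<le> wt c"
    using Max_in[of "wt ` S"] Max_ge[of "wt ` S"]
    by (metis (no_types, lifting) empty_iff finite_imageI image_iff)
  have c1: "odd c" "c \<le> n"
    and c2: "\<And>x. card (odd_cofactors n c0 x) \<le> card (odd_cofactors n c x)"
    using c by (auto simp: S_def)
  have S_I: "c' \<in> S" if "odd c'" "c' \<le> n"
    "\<And>x. card (odd_cofactors n c x) \<le> card (odd_cofactors n c' x)" for c'
    using that order_trans[OF c2] unfolding S_def by blast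
  have cpos: "c > 0" using c1(1) by (rule odd_pos)
  define a where "a = (LEAST a. n \<le> 2 ^ a * c)"
  have "n \<le> 2 ^ n * c" using cpos less_exp[of n]
    by (metis One_nat_def Suc_leI less_imp_le_nat mult.right_neutral mult_le_mono)
  then have a: "n \<le> 2 ^ a * c" unfolding a_def by (rule LeastI)
  have amin: "2 ^ i * c < n" if "i < a" for i
    using not_less_Least[of i "\<lambda>a. n \<le> 2 ^ a * c"] that unfolding a_def by simp
  define m where "m = 2 ^ a * c"
  \<comment> \<open>For \<open>a = 0\<close>, \<open>n \<le> c \<le> n\<close>. Otherwise minimality
    of \<open>a\<close> bounds \<open>m div 2\<close> by \<open>n - 1\<close>.\<close>
  have m_small: "m = n \<or> m \<le> 2 * n - 2"
  proof (cases a)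
    case 0
    then show ?thesis using a c1 by (simp add: m_def)
  next
    case (Suc i)
    then have "2 ^ i * c < n" using amin by simp
    moreover have "m = 2 * (2 ^ i * c)" using Suc by (simp add: m_def)
    ultimately show ?thesis by linarith
  qed
  have "m > 0" using cpos by (simp add: m_def)
  have expo1: "expo m 1 = a"
    unfolding expo_def ith_prime_1 m_def using c1 by (intro multiplicity_eqI) auto
  have expo: "expo m i = multiplicity (ith_prime i) c" if "i > 1" for i
  proof -
    have "ith_prime i \<noteq> 2" using odd_ith_prime[OF that] by auto
    then show ?thesis
      unfolding expo_def m_def using prime_ith_prime[of i] cpos
      by (simp add: prime_elem_multiplicity_mult_distrib prime_imp_prime_elem
          multiplicity_distinct_prime_power)
  qed
  have red1: "real_of_int \<lfloor>real (expo m i + 1) / real (expo m j + 2)\<rfloor>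
          < ln (real (ith_prime j)) / ln (real (ith_prime i))" if ij: "1 < i" "1 < j" for i j
  proof (rule ccontr)
    assume contra: "\<not> ?thesis"
    define p q where "p = ith_prime i" and "q = ith_prime j"
    define k where "k = (multiplicity p c + 1) div (multiplicity q c + 2)"
    have pq: "prime p" "prime q" "odd q" using prime_ith_prime odd_ith_prime ij
      by (auto simp: p_def q_def)
    have p1: "real p > 1" and q1: "real q > 1" using pq prime_gt_1_nat by auto
    have "\<lfloor>real (expo m i + 1) / real (expo m j + 2)\<rfloor> = int k"
      unfolding expo[OF ij(1)] expo[OF ij(2)] k_def p_def[symmetric] q_def[symmetric]
      by (rule floor_divide_of_nat_eq)
    with contra have "ln (real q) / ln (real p) \<le> real k" by (simp add: p_def q_def)
    then have lnle: "ln (real q) \<le> real k * ln (real p)" using p1 by (simp add: field_simps)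
    also have "\<dots> = ln (real p ^ k)" using p1 by (simp add: ln_realpow)
    finally have "real q \<le> real (p ^ k)" using p1 q1 by simp
    then have qle: "q \<le> p ^ k" by linarith
    have "k > 0" using qle prime_gt_1_nat[OF pq(2)] by (cases k) auto
    \<comment> \<open>For \<open>p = q\<close> the quotient \<open>k\<close> would have the form
      \<open>(e + 1) div (e + 2) = 0\<close>.\<close>
    have "p \<noteq> q" using \<open>k > 0\<close> by (auto simp: k_def)
    have "q \<noteq> p ^ k"
    proof
      assume "q = p ^ k"
      then have "p dvd q" using \<open>k > 0\<close> by simp
      with pq \<open>p \<noteq> q\<close> show False using primes_dvd_imp_eq by blast
    qed
    with qle have "q < p ^ k" by simp
    moreover have "k * (multiplicity q c + 2) \<le> multiplicity p c + 1"
      unfolding k_def by (rule div_times_less_eq_dividend)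
    ultimately obtain c' f where c': "c' > 0" "c' < c" "odd c \<Longrightarrow> odd q \<Longrightarrow> odd c'"
      and f: "inj_on f {u. u dvd c}" "f ` {u. u dvd c} \<subseteq> {u. u dvd c'}"
        "\<And>N x. f ` odd_cofactors N c x \<subseteq> odd_cofactors N c' x"
      using exchange_primes[OF cpos pq(1,2) \<open>p \<noteq> q\<close>] by metis
    have "card (odd_cofactors n c x) \<le> card (odd_cofactors n c' x)" for x
    proof (rule card_inj_on_le[OF _ f(3)])
      show "inj_on f (odd_cofactors n c x)"
        using f(1) by (rule inj_on_subset) (auto simp: odd_cofactors_def)
    qed (rule finite_odd_cofactors[OF c'(1)])
    then have "c' \<in> S" using c' c1 pq by (intro S_I) auto
    moreover have "tau c \<le> tau c'"
      unfolding tau_def using f(1,2) c'(1) by (intro card_inj_on_le) auto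
    then have "tau c * (n + 1) \<le> tau c' * (n + 1)" by (rule mult_le_mono1)
    then have "wt c < wt c'" unfolding wt_def using c'(2) c1(2) by linarith
    ultimately show False using cmax[of c'] by simp
  qed
  have red2: "2 ^ expo m 1 < 8 * (ith_prime j)\<^sup>2" if j: "j \<ge> 1" "expo m j = 0" for j
  proof (rule ccontr)
    assume contra: "\<not> ?thesis"
    define q where "q = ith_prime j"
    have q: "prime q" "q > 0" using prime_ith_prime prime_gt_0_nat by (auto simp: q_def)
    have big: "8 * q\<^sup>2 \<le> 2 ^ a" using contra unfolding expo1 q_def by simp
    have "j \<noteq> 1"
    proof
      assume "j = 1"
      then have "a = 0" using j(2) expo1 by metis
      with big have "8 * q\<^sup>2 \<le> 1" by simp
      moreover have "q\<^sup>2 > 0" using q(2) by simp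
      ultimately show False by linarith
    qed
    with j have j1: "j > 1" by simp
    have nq: "\<not> q dvd c"
      using j(2) expo[OF j1] prime_multiplicity_gt_zero_iff[of q c] q cpos
      by (simp add: q_def prime_imp_prime_elem)
    \<comment> \<open>Since \<open>m \<le> 2 * n\<close>, the factor 8 leaves room for
      \<open>c * q\<^sup>2 \<le> n\<close>.\<close>
    have "c * (8 * q\<^sup>2) \<le> m" unfolding m_def using big by (simp add: mult.commute)
    then have cq2: "c * q\<^sup>2 \<le> n" using m_small by linarith
    have "q \<le> q\<^sup>2" using q by (simp add: power2_eq_square)
    then have "c * q \<le> c * q\<^sup>2" by (rule mult_le_mono2)
    with cq2 have "c * q \<le> n" by linarith
    moreover have "card (odd_cofactors n c x) \<le> card (odd_cofactors n (c * q) x)" for x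
      by (rule card_odd_cofactors_adjoin_prime[OF cpos q(1) nq cq2])
    moreover have "odd (c * q)" using c1 odd_ith_prime[OF j1] by (simp add: q_def)
    ultimately have "c * q \<in> S" by (intro S_I)
    moreover have "tau c < tau (c * q)"
      unfolding tau_def
    proof (rule psubset_card_mono)
      show "finite {u. u dvd c * q}" using cpos q by simp
      have "q \<in> {u. u dvd c * q}" "q \<notin> {u. u dvd c}" using nq by auto
      then show "{u. u dvd c} \<subset> {u. u dvd c * q}" by auto
    qed
    \<comment> \<open>One more divisor adds \<open>n + 1\<close> to \<open>wt\<close>, more than the
      drop in \<open>n - c\<close>, which is at most \<open>n\<close>.\<close>
    then have "(tau c + 1) * (n + 1) \<le> tau (c * q) * (n + 1)" by (intro mult_le_mono1) simp
    then have "tau c * (n + 1) + (n + 1) \<le> tau (c * q) * (n + 1)"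
      by (simp only: add_mult_distrib mult_1)
    then have "wt c < wt (c * q)" unfolding wt_def by linarith
    ultimately show False using cmax[of "c * q"] by simp
  qed
  have "card (maxdivs x n) \<le> card (maxdivs x m)" for x
  proof -
    have "card (maxdivs x n) \<le> card (odd_cofactors n c0 x)"
      using card_maxdivs_le[OF n(2)] n(1) by metis
    also have "\<dots> \<le> card (odd_cofactors n c x)" by (rule c2)
    \<comment> \<open>Raising the bound from \<open>n\<close> to \<open>m = 2 ^ a * c\<close>
      restores the form in which cofactors count maximal divisors.\<close>
    also have "\<dots> \<le> card (odd_cofactors m c x)"
      using odd_cofactors_mono[of n m] a finite_odd_cofactors[OF cpos]
      by (intro card_mono) (auto simp: m_def)
    also have "\<dots> \<le> card (maxdivs x m)" unfolding m_def by (rule card_odd_cofactors_le[OF c1(1)])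
    finally show ?thesis .
  qed
  moreover have "reduced m" unfolding reduced_def using red1 red2 \<open>m > 0\<close> by blast
  moreover have "n \<le> m" using a by (simp add: m_def)
  \<comment> \<open>Both \<open>n\<close> and \<open>2 * n - 2\<close> are at most
    \<open>4 * n - 6\<close> once \<open>n \<ge> 2\<close>.\<close>
  moreover have "m \<le> 4 * n - 6" using m_small assms by linarith
  ultimately show ?thesis by blast
qed

end
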